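(* Let $G=(\mathcal V,\mathcal E)$ be a finite undirected graph with finite label sets $X_v$ ($v\in\mathcal V$) and potentials $\theta_v:X_v\to\mathbb R$, $\theta_{uv}:X_u\times X_v\to\mathbb R$. Let $A\subset\mathcal V$ and $x^0\in X_A$. If $$x^0\in\operatorname*{arg\,min}_{x\in X_A}\hat E_{A,x^0}(x),$$ where $\hat E_{A,x^0}$ is the energy on $A$ augmented with boundary potentials for the test labeling $x^0$, then $x^0$ is persistent on $A$, i.e. there is a minimizer $x^\ast$ of $E_{\mathcal V}$ over $X_{\mathcal V}$ with $x^\ast_v=x^0_v$ for all $v\in A$.
   Context: For $A\subset\mathcal V$, $X_A=\prod_{v\in A}X_v$, with label sets finite and nonempty, and $\theta_{uv}(x_u,x_v)=\theta_{vu}(x_v,x_u)$. The energy is $E_A(x)=\sum_{u\in A}\theta_u(x_u)+\sum_{uv\in\mathcal E:\,u,v\in A}\theta_{uv}(x_u,x_v)$ for $x\in X_A$; in particular $E_{\mathcal V}$ is the full energy. Boundary nodes: $\partial\mathcal V_A=\{u\in A:\exists v\in\mathcal V\setminus A,\ uv\in\mathcal E\}$. Boundary edges: $\partial\mathcal E_A=\{uv\in\mathcal E:u\in A,\ v\in\mathcal V\setminus A\}$. For a boundary edge $uv$ with $u\in A$, $v\notin A$ and a test label $y_u\in X_u$, the boundary potential is $$\hat\theta_{uv,y_u}(x_u)=\begin{cases}\max_{x_v\in X_v}\theta_{uv}(x_u,x_v),&x_u=y_u,\\ \min_{x_v\in X_v}\theta_{uv}(x_u,x_v),&x_u\ne y_u.\end{cases}$$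 For a test labeling $y$ (a labeling of $\partial\mathcal V_A$; a labeling of a larger set is used through its restriction to $\partial\mathcal V_A$), $\hat E_{A,y}(x)=E_A(x)+\sum_{uv\in\partial\mathcal E_A:\,u\in\partial\mathcal V_A}\hat\theta_{uv,y_u}(x_u)$ for $x\in X_A$. *)

theory Defs
  imports Complex_Main "HOL-Library.FuncSet"
begin

text \<open>
  A pairwise model consists of a node set \<open>V\<close>, an edge set \<open>E\<close> of unordered pairs
  \<open>{u, v}\<close>, label sets \<open>X v\<close>, unary potentials \<open>\<theta>1 u\<close> and pairwise potentials \<open>\<theta>2 u v\<close>
  with \<open>\<theta>2 u v a b = \<theta>2 v u b a\<close> on edges. The labelings of \<open>A\<close> are \<open>Pi\<^sub>E A X\<close>.
\<close>

text \<open>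
  The value of \<open>\<theta>2\<close> on an undirected edge does not depend on the chosen orientation; the
  description below is proper exactly because of the symmetry of \<open>\<theta>2\<close>, see
  \<open>edge_potential_eq\<close>.
\<close>

definition edge_potential ::
    "('v \<Rightarrow> 'v \<Rightarrow> 'l \<Rightarrow> 'l \<Rightarrow> real) \<Rightarrow> ('v \<Rightarrow> 'l) \<Rightarrow> 'v set \<Rightarrow> real" where
  "edge_potential \<theta>2 x e = (THE r. \<exists>u v. e = {u, v} \<and> r = \<theta>2 u v (x u) (x v))"

lemma edge_potential_eq:
  assumes "\<theta>2 u v (x u) (x v) = \<theta>2 v u (x v) (x u)"
  shows "edge_potential \<theta>2 x {u, v} = \<theta>2 u v (x u) (x v)"
  unfolding edge_potential_def
  by (rule the_equality) (use assms in \<open>auto simp: doubleton_eq_iff\<close>)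

definition energy ::
    "'v set set \<Rightarrow> ('v \<Rightarrow> 'l \<Rightarrow> real) \<Rightarrow> ('v \<Rightarrow> 'v \<Rightarrow> 'l \<Rightarrow> 'l \<Rightarrow> real) \<Rightarrow> 'v set
      \<Rightarrow> ('v \<Rightarrow> 'l) \<Rightarrow> real" where
  "energy E \<theta>1 \<theta>2 A x =
     (\<Sum>u\<in>A. \<theta>1 u (x u)) + (\<Sum>e\<in>{e \<in> E. e \<subseteq> A}. edge_potential \<theta>2 x e)"

definition boundary_nodes :: "'v set \<Rightarrow> 'v set set \<Rightarrow> 'v set \<Rightarrow> 'v set" where
  "boundary_nodes V E A = {u \<in> A. \<exists>v \<in> V - A. {u, v} \<in> E}"

text \<open>
  Exactly one endpoint of a boundary edge lies in \<open>A\<close>, so boundary edges are listed, each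
  once, as pairs whose first component is that endpoint.
\<close>

definition boundary_edges :: "'v set \<Rightarrow> 'v set set \<Rightarrow> 'v set \<Rightarrow> ('v \<times> 'v) set" where
  "boundary_edges V E A = {(u, v). {u, v} \<in> E \<and> u \<in> A \<and> v \<in> V - A}"

definition boundary_potential ::
    "('v \<Rightarrow> 'l set) \<Rightarrow> ('v \<Rightarrow> 'v \<Rightarrow> 'l \<Rightarrow> 'l \<Rightarrow> real) \<Rightarrow> 'v \<Rightarrow> 'v \<Rightarrow> 'l \<Rightarrow> 'l \<Rightarrow> real" where
  "boundary_potential X \<theta>2 u v yu xu =
     (if xu = yu then Max ((\<lambda>xv. \<theta>2 u v xu xv) ` X v)
      else Min ((\<lambda>xv. \<theta>2 u v xu xv) ` X v))"

text \<open>Only the values of the test labeling \<open>y\<close> on the boundary nodes of \<open>A\<close> are used.\<close>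

definition augmented_energy ::
    "'v set \<Rightarrow> 'v set set \<Rightarrow> ('v \<Rightarrow> 'l set) \<Rightarrow> ('v \<Rightarrow> 'l \<Rightarrow> real)
      \<Rightarrow> ('v \<Rightarrow> 'v \<Rightarrow> 'l \<Rightarrow> 'l \<Rightarrow> real) \<Rightarrow> 'v set \<Rightarrow> ('v \<Rightarrow> 'l) \<Rightarrow> ('v \<Rightarrow> 'l) \<Rightarrow> real" where
  "augmented_energy V E X \<theta>1 \<theta>2 A y x =
     energy E \<theta>1 \<theta>2 A x +
     (\<Sum>(u, v)\<in>{(u, v) \<in> boundary_edges V E A. u \<in> boundary_nodes V E A}.
        boundary_potential X \<theta>2 u v (y u) (x u))"

definition persistent ::
    "'v set \<Rightarrow> 'v set set \<Rightarrow> ('v \<Rightarrow> 'l set) \<Rightarrow> ('v \<Rightarrow> 'l \<Rightarrow> real)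
      \<Rightarrow> ('v \<Rightarrow> 'v \<Rightarrow> 'l \<Rightarrow> 'l \<Rightarrow> real) \<Rightarrow> 'v set \<Rightarrow> ('v \<Rightarrow> 'l) \<Rightarrow> bool" where
  "persistent V E X \<theta>1 \<theta>2 A x0 \<longleftrightarrow>
     (\<exists>x. is_arg_min (energy E \<theta>1 \<theta>2 V) (\<lambda>z. z \<in> Pi\<^sub>E V X) x \<and> (\<forall>v\<in>A. x v = x0 v))"

end

theory Submission
  imports Defs
begin

text \<open>
  Take any minimizer \<open>x\<close> of the full energy and overwrite it by \<open>x0\<close> on \<open>A\<close>. The edges
  outside \<open>A\<close> are unaffected. On a boundary edge the change of the pairwise term is at most
  the change of the boundary potential: nothing happens where \<open>x\<close> and \<open>x0\<close> agree, and
  elsewhere the new term is at most the maximum while the old one is at least the minimum.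
  Hence the full energy changes by at most the change of the augmented energy from \<open>x\<close>
  restricted to \<open>A\<close> to \<open>x0\<close>, which is nonpositive.
\<close>

text \<open>Both descriptions have equivalent defining predicates, so they agree even where no
  unique value is described.\<close>

lemma edge_potential_cong:
  assumes "\<And>u. u \<in> e \<Longrightarrow> x u = y u"
  shows "edge_potential \<theta>2 x e = edge_potential \<theta>2 y e"
proof -
  have "(\<exists>u v. e = {u, v} \<and> r = \<theta>2 u v (x u) (x v))
      \<longleftrightarrow> (\<exists>u v. e = {u, v} \<and> r = \<theta>2 u v (y u) (y v))" for r
    using assms by (metis insertCI)
  then show ?thesis
    unfolding edge_potential_def by presburger
qed

lemma energy_cong:
  assumes "\<And>u. u \<in> A \<Longrightarrow> x u = y u"
  shows "energy E \<theta>1 \<theta>2 A x = energy E \<theta>1 \<theta>2 A y"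
  unfolding energy_def
  by (intro arg_cong2[where f = "(+)"] sum.cong refl edge_potential_cong)
     (use assms in auto)

lemma finite_boundary_edges:
  assumes "finite V" "A \<subseteq> V"
  shows "finite (boundary_edges V E A)"
  by (rule finite_subset[of _ "V \<times> V"]) (use assms in \<open>auto simp: boundary_edges_def\<close>)

lemma augmented_energy_eq:
  "augmented_energy V E X \<theta>1 \<theta>2 A y x =
     energy E \<theta>1 \<theta>2 A x +
     (\<Sum>(u, v)\<in>boundary_edges V E A. boundary_potential X \<theta>2 u v (y u) (x u))"
proof -
  have "{(u, v) \<in> boundary_edges V E A. u \<in> boundary_nodes V E A} = boundary_edges V E A"
    by (auto simp: boundary_edges_def boundary_nodes_def)
  then show ?thesis
    by (simp add: augmented_energy_def)
qed

text \<open>Every edge lies within \<open>A\<close>, crosses the boundary or lies within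
  \<open>V - A\<close>. This isolates the only terms that couple labels in \<open>A\<close> to
  labels outside; symmetry lets a crossing edge be read from its endpoint in
  \<open>A\<close>.\<close>

lemma energy_split:
  assumes "finite V" and "A \<subseteq> V"
    and E: "E \<subseteq> {{u, v} | u v. u \<in> V \<and> v \<in> V}"
    and sym: "\<And>u v. \<lbrakk>u \<in> V; v \<in> V; {u, v} \<in> E\<rbrakk> \<Longrightarrow> \<theta>2 u v (x u) (x v) = \<theta>2 v u (x v) (x u)"
  shows "energy E \<theta>1 \<theta>2 V x =
    energy E \<theta>1 \<theta>2 A x + (\<Sum>(u, v)\<in>boundary_edges V E A. \<theta>2 u v (x u) (x v))
      + energy E \<theta>1 \<theta>2 (V - A) x"
proof -
  let ?B = "(\<lambda>(u, v). {u, v}) ` boundary_edges V E A"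
  let ?p = "edge_potential \<theta>2 x"
  have "finite E"
    by (rule finite_subset[of _ "Pow V"]) (use E \<open>finite V\<close> in auto)
  have "finite ?B"
    using finite_boundary_edges[OF assms(1,2)] by blast
  have split: "{e \<in> E. e \<subseteq> V} = ({e \<in> E. e \<subseteq> A} \<union> ?B) \<union> {e \<in> E. e \<subseteq> V - A}" (is "?l = ?r")
  proof
    show "?l \<subseteq> ?r"
    proof
      fix e
      assume "e \<in> ?l"
      then obtain u v where e: "e = {u, v}" "e \<in> E" and uv: "u \<in> V" "v \<in> V"
        using E by blast
      moreover have "e \<in> ?B" if "u \<in> A" "v \<notin> A"
        using that e uv by (intro image_eqI[of _ _ "(u, v)"]) (auto simp: boundary_edges_def)
      moreover have "e \<in> ?B" if "v \<in> A" "u \<notin> A"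
        using that e uv
        by (intro image_eqI[of _ _ "(v, u)"]) (auto simp: boundary_edges_def insert_commute)
      ultimately show "e \<in> ?r"
        by auto
    qed
    show "?r \<subseteq> ?l"
      using \<open>A \<subseteq> V\<close> by (auto simp: boundary_edges_def)
  qed
  \<comment> \<open>Exactly one endpoint lies in \<open>A\<close>, so the unordered edge determines
    its orientation.\<close>
  have "inj_on (\<lambda>(u, v). {u, v}) (boundary_edges V E A)"
    by (auto simp: inj_on_def boundary_edges_def doubleton_eq_iff)
  then have "sum ?p ?B = (\<Sum>(u, v)\<in>boundary_edges V E A. ?p {u, v})"
    by (simp add: sum.reindex case_prod_unfold)
  also have "\<dots> = (\<Sum>(u, v)\<in>boundary_edges V E A. \<theta>2 u v (x u) (x v))"
    using \<open>A \<subseteq> V\<close>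
    by (intro sum.cong refl) (auto simp: boundary_edges_def intro!: edge_potential_eq sym)
  finally have B: "sum ?p ?B = (\<Sum>(u, v)\<in>boundary_edges V E A. \<theta>2 u v (x u) (x v))" .
  have "sum ?p {e \<in> E. e \<subseteq> V} =
      sum ?p ({e \<in> E. e \<subseteq> A} \<union> ?B) + sum ?p {e \<in> E. e \<subseteq> V - A}"
    unfolding split
  proof (rule sum.union_disjoint)
    \<comment> \<open>Only the empty set could belong to both families, and an edge has an
      endpoint.\<close>
    have disjoint: "e = {}" if "e \<subseteq> V - A" "e \<subseteq> A" for e
      using that by blast
    have "{} \<notin> E"
      using E by auto
    then show "({e \<in> E. e \<subseteq> A} \<union> ?B) \<inter> {e \<in> E. e \<subseteq> V - A} = {}"
      by (auto simp: boundary_edges_def dest: disjoint)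
  qed (use \<open>finite E\<close> \<open>finite ?B\<close> in auto)
  also have "sum ?p ({e \<in> E. e \<subseteq> A} \<union> ?B) = sum ?p {e \<in> E. e \<subseteq> A} + sum ?p ?B"
    by (rule sum.union_disjoint)
       (use \<open>finite E\<close> \<open>finite ?B\<close> in \<open>auto simp: boundary_edges_def\<close>)
  finally have "sum ?p {e \<in> E. e \<subseteq> V} =
      sum ?p {e \<in> E. e \<subseteq> A} + sum ?p ?B + sum ?p {e \<in> E. e \<subseteq> V - A}" .
  moreover have "(\<Sum>u\<in>V. \<theta>1 u (x u)) = (\<Sum>u\<in>V - A. \<theta>1 u (x u)) + (\<Sum>u\<in>A. \<theta>1 u (x u))"
    using assms(1,2) by (simp add: sum.subset_diff)
  ultimately show ?thesis
    unfolding energy_def B by linarith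
qed

text \<open>The estimate for one boundary edge: \<open>y\<close> is the test label at
  \<open>u\<close>, \<open>a\<close> the label it replaces, and \<open>b\<close> the label at
  \<open>v\<close>, which stays fixed.\<close>

lemma boundary_potential_diff:
  assumes "finite (X v)" "b \<in> X v"
  shows "\<theta>2 u v y b + boundary_potential X \<theta>2 u v y a
    \<le> \<theta>2 u v a b + boundary_potential X \<theta>2 u v y y"
proof (cases "a = y")
  case False
  have "Min (\<theta>2 u v a ` X v) \<le> \<theta>2 u v a b" "\<theta>2 u v y b \<le> Max (\<theta>2 u v y ` X v)"
    using assms by auto
  with False show ?thesis
    by (simp add: boundary_potential_def)
qed simp

theorem theorem1:
  fixes V :: "'v set" and E :: "'v set set" and X :: "'v \<Rightarrow> 'l set"
    and \<theta>1 :: "'v \<Rightarrow> 'l \<Rightarrow> real" and \<theta>2 :: "'v \<Rightarrow> 'v \<Rightarrow> 'l \<Rightarrow> 'l \<Rightarrow> real"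
    and A :: "'v set" and x0 :: "'v \<Rightarrow> 'l"
  assumes "finite V"
    and "E \<subseteq> {{u, v} | u v. u \<in> V \<and> v \<in> V}"
    and "\<And>v. v \<in> V \<Longrightarrow> finite (X v)"
    and "\<And>v. v \<in> V \<Longrightarrow> X v \<noteq> {}"
    and "\<And>u v a b. \<lbrakk>u \<in> V; v \<in> V; {u, v} \<in> E; a \<in> X u; b \<in> X v\<rbrakk> \<Longrightarrow> \<theta>2 u v a b = \<theta>2 v u b a"
    and "A \<subseteq> V"
    and "x0 \<in> Pi\<^sub>E A X"
    and "is_arg_min (augmented_energy V E X \<theta>1 \<theta>2 A x0) (\<lambda>x. x \<in> Pi\<^sub>E A X) x0"
  shows "persistent V E X \<theta>1 \<theta>2 A x0"
proof -
  let ?F = "energy E \<theta>1 \<theta>2 V"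
  let ?bp = "\<lambda>w. \<Sum>(u, v)\<in>boundary_edges V E A. boundary_potential X \<theta>2 u v (x0 u) (w u)"
  let ?bt = "\<lambda>w. \<Sum>(u, v)\<in>boundary_edges V E A. \<theta>2 u v (w u) (w v)"
  have split: "?F w = energy E \<theta>1 \<theta>2 A w + ?bt w + energy E \<theta>1 \<theta>2 (V - A) w"
    if "w \<in> Pi\<^sub>E V X" for w
    by (rule energy_split[OF assms(1,6,2)]) (use that assms(5) in \<open>meson PiE_mem\<close>)
  have "finite (Pi\<^sub>E V X)" "Pi\<^sub>E V X \<noteq> {}"
    using assms(1,3,4) by (auto intro: finite_PiE simp: PiE_eq_empty_iff)
  then obtain x where x: "x \<in> Pi\<^sub>E V X" and x_min: "\<And>w. w \<in> Pi\<^sub>E V X \<Longrightarrow> ?F x \<le> ?F w"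
    using ex_is_arg_min_if_finite[of "Pi\<^sub>E V X" ?F] by (force simp: is_arg_min_linorder)
  define z where "z = override_on x x0 A"
  \<comment> \<open>As \<open>A\<close> is contained in \<open>V\<close>, overwriting keeps the
    value \<open>undefined\<close> that \<open>x\<close> has outside \<open>V\<close>.\<close>
  have z: "z \<in> Pi\<^sub>E V X"
    using x \<open>x0 \<in> Pi\<^sub>E A X\<close> \<open>A \<subseteq> V\<close> by (auto simp: z_def override_on_def PiE_iff extensional_def)
  \<comment> \<open>Minimality of \<open>x0\<close> compares only labelings that are
    \<open>undefined\<close> outside \<open>A\<close>, so \<open>x\<close> is first cut down to
    \<open>A\<close>; the energies involved read only labels in \<open>A\<close>.\<close>
  have "restrict x A \<in> Pi\<^sub>E A X"
    using x \<open>A \<subseteq> V\<close> by auto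
  then have "energy E \<theta>1 \<theta>2 A x0 + ?bp x0
      \<le> energy E \<theta>1 \<theta>2 A (restrict x A) + ?bp (restrict x A)"
    using assms(8) unfolding is_arg_min_linorder augmented_energy_eq by blast
  moreover have "?bp (restrict x A) = ?bp x"
    by (rule sum.cong) (auto simp: boundary_edges_def)
  moreover have "energy E \<theta>1 \<theta>2 A (restrict x A) = energy E \<theta>1 \<theta>2 A x"
    by (rule energy_cong) simp
  moreover have "energy E \<theta>1 \<theta>2 A z = energy E \<theta>1 \<theta>2 A x0"
    by (rule energy_cong) (simp add: z_def)
  moreover have "energy E \<theta>1 \<theta>2 (V - A) z = energy E \<theta>1 \<theta>2 (V - A) x"
    by (rule energy_cong) (simp add: z_def)
  moreover have "?bt z + ?bp x \<le> ?bt x + ?bp x0"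
    unfolding sum.distrib[symmetric]
  proof (rule sum_mono, clarify)
    fix u v
    assume "(u, v) \<in> boundary_edges V E A"
    then have "u \<in> A" "v \<in> V" "v \<notin> A"
      by (auto simp: boundary_edges_def)
    \<comment> \<open>Here \<open>z u = x0 u\<close> and \<open>z v = x v\<close>.\<close>
    then show "\<theta>2 u v (z u) (z v) + boundary_potential X \<theta>2 u v (x0 u) (x u)
        \<le> \<theta>2 u v (x u) (x v) + boundary_potential X \<theta>2 u v (x0 u) (x0 u)"
      using boundary_potential_diff[of X v "x v" \<theta>2 u "x0 u" "x u"] assms(3) x
      by (auto simp: z_def)
  qed
  \<comment> \<open>Adding the boundary estimate to the minimality inequality cancels
    \<open>?bp x\<close> and \<open>?bp x0\<close>; the parts on \<open>V - A\<close>
    coincide.\<close>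
  ultimately have "?F z \<le> ?F x"
    using split[OF z] split[OF x] by linarith
  then have "is_arg_min ?F (\<lambda>w. w \<in> Pi\<^sub>E V X) z"
    using z x_min by (force simp: is_arg_min_linorder)
  moreover have "\<forall>v\<in>A. z v = x0 v"
    by (simp add: z_def)
  ultimately show ?thesis
    unfolding persistent_def by blast
qed

end
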